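(* For every fixed integer $r\ge3$ and real number $s>\frac{r}{r-1}$, put $\alpha_{r,s}=\frac{s}{(r-1)s-r}$. There is a constant $c=c(r,s)>0$ such that, for all sufficiently large $n$ (depending on $r,s$) and every real $d$ with $s\le d\le n^{1/\alpha_{r,s}}$, writing $w=nd^{-\alpha_{r,s}}$ and $\Lambda=\log(2+nd)$, we have $$t_r(n,d,s)\ge c\left(w+\frac{\Lambda}{\log(2+\Lambda/w)}\right).$$
   Context: An $r$-graph ($r$-uniform hypergraph) is a pair $H=(V(H),E(H))$ with $V(H)$ a finite set and $E(H)\subseteq\binom{V(H)}{r}$; $e(H)=|E(H)|$. An $r$-graph $F$ is a subhypergraph of $H$ if $V(F)\subseteq V(H)$ and $E(F)\subseteq E(H)$. The average degree of an $r$-graph $H$ with nonempty vertex set is $\overline d(H)=r\,e(H)/|V(H)|$. For real numbers $d\ge s>1$, $t_r(n,d,s)$ denotes the smallest integer $t$ such that every $n$-vertex $r$-graph $H$ with $\overline d(H)\ge d$ contains a nonempty subhypergraph $H'$ with $|V(H')|\le t$ and $\overline d(H')\ge s$. Here $d$ may depend on $n$. *)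

theory Defs
  imports Complex_Main "HOL-Library.Ramsey"
begin

type_synonym 'a hypergraph = "'a set \<times> 'a set set"

abbreviation hverts :: "'a hypergraph \<Rightarrow> 'a set" where
  "hverts H \<equiv> fst H"

abbreviation hedges :: "'a hypergraph \<Rightarrow> 'a set set" where
  "hedges H \<equiv> snd H"

definition r_graph :: "nat \<Rightarrow> 'a hypergraph \<Rightarrow> bool" where
  "r_graph r H \<longleftrightarrow> finite (hverts H) \<and> hedges H \<subseteq> nsets (hverts H) r"

definition subhypergraph :: "'a hypergraph \<Rightarrow> 'a hypergraph \<Rightarrow> bool" where
  "subhypergraph F H \<longleftrightarrow> hverts F \<subseteq> hverts H \<and> hedges F \<subseteq> hedges H"

definition avg_degree :: "nat \<Rightarrow> 'a hypergraph \<Rightarrow> real" where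
  "avg_degree r H = real r * real (card (hedges H)) / real (card (hverts H))"

text \<open>
  Since every finite hypergraph is isomorphic to one with vertices in the natural numbers,
  it suffices to quantify over hypergraphs of that vertex type.
\<close>

definition dense_sub_bound :: "nat \<Rightarrow> nat \<Rightarrow> real \<Rightarrow> real \<Rightarrow> nat \<Rightarrow> bool" where
  "dense_sub_bound r n d s t \<longleftrightarrow>
     (\<forall>H :: nat hypergraph. r_graph r H \<and> card (hverts H) = n \<and> avg_degree r H \<ge> d \<longrightarrow>
        (\<exists>H'. r_graph r H' \<and> subhypergraph H' H \<and> hverts H' \<noteq> {} \<and>
              card (hverts H') \<le> t \<and> avg_degree r H' \<ge> s))"

text \<open>
  For \<open>d \<ge> s > 1\<close> the minimum exists, because \<open>t = n\<close> qualifies (take \<open>H' = H\<close>). No negative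
  integer qualifies as soon as some \<open>n\<close>-vertex \<open>r\<close>-graph has average degree at least \<open>d\<close>, so
  the minimum over the naturals is then the minimum over the integers.
\<close>

definition t_sub :: "nat \<Rightarrow> nat \<Rightarrow> real \<Rightarrow> real \<Rightarrow> nat" where
  "t_sub r n d s = (LEAST t. dense_sub_bound r n d s t)"

definition alpha :: "nat \<Rightarrow> real \<Rightarrow> real" where
  "alpha r s = s / ((real r - 1) * s - real r)"

end

theory Submission
  imports Defs "HOL-Real_Asymp.Real_Asymp"
begin

text \<open>
  Choose a uniformly random set of \<open>M \<approx> 2nd/r\<close> edges. Writing \<open>\<beta> = ((r - 1)s - r)/r\<close>, the expected
  number of pairs of a \<open>k\<close>-set \<open>U\<close> and \<open>\<lceil>sk/r\<rceil>\<close> chosen edges inside \<open>U\<close> is at most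
  \<open>(C (k/w)\<^sup>\<beta>)\<^sup>k\<close>. Let \<open>L = \<Lambda> / ln (2 + \<Lambda>/w)\<close> and \<open>k \<le> c(w + L)\<close> with \<open>c\<close> small. If \<open>L \<le> w\<close>, each
  of these terms is at most 1; if \<open>w < L\<close>, each is at most \<open>exp (\<Lambda>/2)\<close> and there are at most \<open>\<Lambda>\<close> of
  them. In both cases the total is at most \<open>nd/r\<close>, so deleting one edge from each such pair leaves
  average degree at least \<open>d\<close> and no small subhypergraph of average degree at least \<open>s\<close>.
\<close>

section \<open>Random \<open>M\<close>-subsets and the deletion method\<close>

lemma card_supersets_le:
  assumes "finite E" "B \<subseteq> E"
  shows "card {A \<in> nsets E M. B \<subseteq> A} \<le> (card E - card B) choose (M - card B)"
proof -
  have "card {A \<in> nsets E M. B \<subseteq> A} \<le> card (nsets (E - B) (M - card B))"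
  proof (rule card_inj_on_le)
    show "inj_on (\<lambda>A. A - B) {A \<in> nsets E M. B \<subseteq> A}"
      by (rule inj_onI) blast
    show "(\<lambda>A. A - B) ` {A \<in> nsets E M. B \<subseteq> A} \<subseteq> nsets (E - B) (M - card B)"
      using assms by (auto simp: nsets_def card_Diff_subset finite_subset)
    show "finite (nsets (E - B) (M - card B))"
      using assms by (simp add: finite_imp_finite_nsets)
  qed
  also have "\<dots> = (card E - card B) choose (M - card B)"
    using assms by (simp add: card_Diff_subset finite_subset)
  finally show ?thesis .
qed

text \<open>After division by \<open>card E choose M\<close> the bound concerns the probability that
  a uniformly random \<open>M\<close>-subset of \<open>E\<close> contains \<open>B\<close>. The
  ratio form, which comes from counting pairs of an \<open>M\<close>-set and a
  \<open>card B\<close>-subset of it in two ways, can later be bounded by a power of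
  \<open>M / card E\<close>.\<close>

lemma card_supersets_le_ratio:
  assumes "finite E" "B \<subseteq> E" "M \<le> card E"
  shows "real (card {A \<in> nsets E M. B \<subseteq> A}) \<le>
    real (card E choose M) * (real (M choose card B) / real (card E choose card B))"
proof (cases "card B \<le> M")
  case True
  have "(card E choose M) * (M choose card B) =
      (card E choose card B) * ((card E - card B) choose (M - card B))"
    by (rule choose_mult) (use True assms in auto)
  then have eq: "real (card E choose M) * real (M choose card B) =
      real (card E choose card B) * real ((card E - card B) choose (M - card B))"
    by (metis of_nat_mult)
  have "real (card E choose card B) > 0"
    using True assms by simp
  then have "real ((card E - card B) choose (M - card B)) =
      real (card E choose M) * (real (M choose card B) / real (card E choose card B))"
    using eq by (simp add: field_simps)
  then show ?thesis
    using card_supersets_le[OF assms(1,2), of M] by linarith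
next
  case False
  have "{A \<in> nsets E M. B \<subseteq> A} = {}"
    using False by (auto simp: nsets_def card_mono)
  then show ?thesis by (simp only: card.empty) simp
qed

text \<open>
  The deletion method: average over all \<open>M\<close>-subsets of \<open>E\<close>, then remove one element from each
  forbidden set that the chosen subset contains.
\<close>

lemma exists_large_avoiding_subset:
  fixes f :: "'p \<Rightarrow> 'e set"
  assumes "finite E" "M \<le> card E" "finite P"
    and f: "\<And>p. p \<in> P \<Longrightarrow> f p \<subseteq> E" "\<And>p. p \<in> P \<Longrightarrow> f p \<noteq> {}"
  obtains A where "A \<subseteq> E" "\<And>p. p \<in> P \<Longrightarrow> \<not> f p \<subseteq> A"
    "real (card A) \<ge> real M -
      (\<Sum>p\<in>P. real (M choose card (f p)) / real (card E choose card (f p)))"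
proof -
  define X where "X = (\<Sum>p\<in>P. real (M choose card (f p)) / real (card E choose card (f p)))"
  let ?\<A> = "nsets E M"
  let ?bad = "\<lambda>A. {p \<in> P. f p \<subseteq> A}"
  have fin: "finite ?\<A>"
    using assms by (simp add: finite_imp_finite_nsets)
  have "card ?\<A> > 0"
    using assms by (simp only: card_nsets zero_less_binomial)
  have "(\<Sum>A\<in>?\<A>. card (?bad A)) = (\<Sum>p\<in>P. card {A \<in> ?\<A>. f p \<subseteq> A})"
    by (rule sum_multicount_gen) (use fin assms in auto)
  then have "(\<Sum>A\<in>?\<A>. real (card (?bad A))) = (\<Sum>p\<in>P. real (card {A \<in> ?\<A>. f p \<subseteq> A}))"
    by (metis (no_types, lifting) of_nat_sum sum.cong)
  also have "\<dots> \<le> (\<Sum>p\<in>P. real (card ?\<A>) *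
      (real (M choose card (f p)) / real (card E choose card (f p))))"
    using card_supersets_le_ratio[OF assms(1) f(1) assms(2)] assms(1)
    by (intro sum_mono) simp
  also have "\<dots> = (\<Sum>A\<in>?\<A>. X)"
    by (simp add: X_def sum_distrib_left)
  finally have avg: "(\<Sum>A\<in>?\<A>. real (card (?bad A))) \<le> (\<Sum>A\<in>?\<A>. X)" .
  have "\<exists>A\<in>?\<A>. real (card (?bad A)) \<le> X"
  proof (rule ccontr)
    assume "\<not> ?thesis"
    then have "(\<Sum>A\<in>?\<A>. X) < (\<Sum>A\<in>?\<A>. real (card (?bad A)))"
      using fin \<open>card ?\<A> > 0\<close>
      by (intro sum_strict_mono) (auto simp: not_le simp del: card_nsets)
    with avg show False by simp
  qed
  then obtain A where A: "A \<in> ?\<A>" "real (card (?bad A)) \<le> X" by blast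
  obtain g where g: "\<And>p. p \<in> P \<Longrightarrow> g p \<in> f p"
    using bchoice[of P "\<lambda>p x. x \<in> f p"] f(2) by blast
  have "card (g ` ?bad A) \<le> card (?bad A)"
    using assms by (intro card_image_le) auto
  moreover have "card A - card (g ` ?bad A) \<le> card (A - g ` ?bad A)"
    using assms by (intro diff_card_le_card_Diff) auto
  moreover have "card A = M"
    using A by (simp add: nsets_def)
  ultimately have "real (card (A - g ` ?bad A)) \<ge> real M - X"
    using A(2) by linarith
  show ?thesis
  proof
    show "A - g ` ?bad A \<subseteq> E"
      using A(1) by (auto simp: nsets_def)
    show "\<not> f p \<subseteq> A - g ` ?bad A" if "p \<in> P" for p
      using g[OF that] that by blast
    show "real (card (A - g ` ?bad A)) \<ge> real M -
      (\<Sum>p\<in>P. real (M choose card (f p)) / real (card E choose card (f p)))"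
      using \<open>real (card (A - g ` ?bad A)) \<ge> real M - X\<close> by (simp add: X_def)
  qed
qed

section \<open>Hypergraphs without small dense vertex sets\<close>

text \<open>Deletion is applied to edges, a forbidden set being any \<open>m (card U)\<close> edges
  inside a small nonempty \<open>U\<close>. The summand for \<open>k\<close> is the number of such
  configurations on \<open>k\<close>-sets times the bound on the probability that one of them is
  chosen.\<close>

lemma exists_locally_sparse:
  fixes m :: "nat \<Rightarrow> nat"
  assumes M: "M \<le> n choose r" and m: "\<And>k. k \<ge> 1 \<Longrightarrow> m k \<ge> 1"
  obtains A where "A \<subseteq> nsets {..<n} r"
    "\<And>U. U \<subseteq> {..<n} \<Longrightarrow> U \<noteq> {} \<Longrightarrow> card U \<le> t \<Longrightarrow> card (A \<inter> nsets U r) < m (card U)"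
    "real (card A) \<ge> real M - (\<Sum>k=1..t. real (n choose k) *
        (real ((k choose r) choose m k) * (real (M choose m k) / real ((n choose r) choose m k))))"
proof -
  let ?E = "nsets {..<n} r"
  let ?S = "{U. U \<subseteq> {..<n} \<and> card U \<in> {1..t}}"
  \<comment> \<open>A forbidden edge set is counted once for every \<open>U\<close> that contains
    it. This only weakens the bound, and it makes the sum a plain product for each size of
    \<open>U\<close>.\<close>
  let ?P = "SIGMA U:?S. nsets (nsets U r) (m (card U))"
  let ?q = "\<lambda>k. real (M choose m k) / real ((n choose r) choose m k)"
  let ?h = "\<lambda>U. real ((card U choose r) choose m (card U)) * ?q (card U)"
  have finS: "finite ?S" by simp
  have finU: "finite U" if "U \<in> ?S" for U
    using that by (auto intro: finite_subset)
  have finP: "finite ?P"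
    by (intro finite_SigmaI finS finite_imp_finite_nsets finU)
  have cE: "card ?E = n choose r" by simp
  have 1: "snd p \<subseteq> ?E" if "p \<in> ?P" for p
  proof -
    have "fst p \<subseteq> {..<n}" "snd p \<subseteq> nsets (fst p) r"
      using that by (auto simp: nsets_def[of "nsets _ _"])
    then show ?thesis using nsets_mono by blast
  qed
  have 2: "snd p \<noteq> {}" if "p \<in> ?P" for p
  proof
    assume "snd p = {}"
    with that have "m (card (fst p)) = 0" "card (fst p) \<ge> 1"
      by (auto simp: nsets_def)
    with m show False by fastforce
  qed
  have "finite ?E" by (simp add: finite_imp_finite_nsets)
  then obtain A where A: "A \<subseteq> ?E" "\<And>p. p \<in> ?P \<Longrightarrow> \<not> snd p \<subseteq> A"
    "real (card A) \<ge> real M -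
      (\<Sum>p\<in>?P. real (M choose card (snd p)) / real (card ?E choose card (snd p)))"
    using exists_large_avoiding_subset[of ?E M ?P snd] finP M 1 2 cE by auto
  have "(\<Sum>p\<in>?P. real (M choose card (snd p)) / real (card ?E choose card (snd p))) =
      (\<Sum>(U,B)\<in>?P. ?q (card U))"
    by (intro sum.cong) (auto simp: nsets_def cE[symmetric])
  also have "\<dots> = (\<Sum>U\<in>?S. \<Sum>B\<in>nsets (nsets U r) (m (card U)). ?q (card U))"
    by (intro sum.Sigma[symmetric] finS ballI finite_imp_finite_nsets finU)
  also have "\<dots> = (\<Sum>U\<in>?S. ?h U)"
    by (intro sum.cong refl) (simp del: mem_Collect_eq add: finU)
  also have "\<dots> = (\<Sum>k\<in>{1..t}. \<Sum>U\<in>{U \<in> ?S. card U = k}. ?h U)"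
    using finS by (intro sum.group[symmetric]) auto
  also have "\<dots> = (\<Sum>k=1..t. real (n choose k) *
      (real ((k choose r) choose m k) * ?q k))"
  proof (intro sum.cong refl)
    fix k assume k: "k \<in> {1..t}"
    have "{U \<in> ?S. card U = k} = nsets {..<n} k"
      using k by (auto simp: nsets_def finite_subset)
    then have "card {U \<in> ?S. card U = k} = n choose k"
      by (simp only:) simp
    then show "(\<Sum>U\<in>{U \<in> ?S. card U = k}. ?h U) = real (n choose k) *
      (real ((k choose r) choose m k) * ?q k)"
      by simp
  qed
  finally have sum_eq: "(\<Sum>p\<in>?P. real (M choose card (snd p)) / real (card ?E choose card (snd p))) =
    (\<Sum>k=1..t. real (n choose k) * (real ((k choose r) choose m k) * ?q k))" .
  show ?thesis
  proof
    show "A \<subseteq> ?E" by fact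
    show "real (card A) \<ge> real M - (\<Sum>k=1..t. real (n choose k) *
        (real ((k choose r) choose m k) * ?q k))"
      using A(3) unfolding sum_eq .
    fix U assume U: "U \<subseteq> {..<n}" "U \<noteq> {}" "card U \<le> t"
    show "card (A \<inter> nsets U r) < m (card U)"
    proof (rule ccontr)
      assume "\<not> ?thesis"
      then obtain B where B: "B \<subseteq> A \<inter> nsets U r" "card B = m (card U)" "finite B"
        by (meson not_le obtain_subset_with_card_n)
      have "finite U" using U by (auto intro: finite_subset)
      then have "(U, B) \<in> ?P"
        using U B by (auto simp: nsets_def Suc_le_eq card_gt_0_iff)
      from A(2)[OF this] B show False by auto
    qed
  qed
qed

section \<open>Estimates for binomial coefficients and the expected number of bad pairs\<close>

text \<open>The quotient \<open>k ^ k / fact k\<close> is a single term of the exponential series at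
  \<open>k\<close>, whose terms are all nonnegative.\<close>

lemma power_self_le_exp_fact: "real k ^ k \<le> exp (real k) * fact k"
proof -
  have "real k ^ k /\<^sub>R fact k \<le> (\<Sum>i. real k ^ i /\<^sub>R fact i)"
    using sum_le_suminf[OF summable_exp_generic[of "real k"], of "{k}"] by simp
  then have "real k ^ k / fact k \<le> exp (real k)"
    by (simp add: exp_def field_simps)
  then show ?thesis by (simp add: field_simps)
qed

lemma choose_le_exp_power:
  assumes "k \<ge> 1"
  shows "real (n choose k) \<le> (exp 1 * real n / real k) ^ k"
proof -
  have "real (n choose k) * fact k \<le> real n ^ k"
    using binomial_fact_pow[of n k] by (metis of_nat_fact of_nat_le_iff of_nat_mult of_nat_power)
  then have "real (n choose k) \<le> real n ^ k / fact k"
    by (simp add: field_simps)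
  also have "1 / fact k \<le> exp (real k) / real k ^ k"
    using power_self_le_exp_fact[of k] assms by (simp add: field_simps)
  then have "real n ^ k / fact k \<le> real n ^ k * (exp (real k) / real k ^ k)"
    by (metis mult_left_mono divide_inverse_commute inverse_eq_divide mult.commute of_nat_0_le_iff of_nat_power)
  also have "\<dots> = (exp 1 * real n / real k) ^ k"
    by (simp add: power_mult_distrib power_divide flip: exp_of_nat_mult)
  finally show ?thesis .
qed

text \<open>The numerator is at most \<open>(e M / k) ^ k\<close> and the denominator at least
  \<open>(N / k) ^ k\<close>, so the factors \<open>k\<close> cancel.\<close>

lemma choose_ratio_le:
  assumes "k \<ge> 1" "M \<le> N"
  shows "real (M choose k) / real (N choose k) \<le> (exp 1 * real M / real N) ^ k"
proof (cases "k \<le> N")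
  case True
  have "(real N / real k) ^ k \<le> real (N choose k)"
    using binomial_ge_n_over_k_pow_k[OF True, where 'a = real] by simp
  moreover have "(real N / real k) ^ k > 0"
    using True assms by simp
  ultimately have "real (M choose k) / real (N choose k) \<le>
      (exp 1 * real M / real k) ^ k / (real N / real k) ^ k"
    using choose_le_exp_power[OF assms(1), of M] by (intro frac_le) auto
  also have "\<dots> = (exp 1 * real M / real N) ^ k"
    using assms by (simp add: field_simps)
  finally show ?thesis .
next
  \<comment> \<open>Here the denominator is 0, and division by 0 gives 0.\<close>
  case False
  then show ?thesis by (simp add: binomial_eq_0)
qed

text \<open>
  The assumption \<open>y\<close> makes the base of the power with exponent \<open>m\<close> at most 1, so that \<open>m\<close> may be
  replaced by the real number \<open>s * k / r\<close>, which it exceeds through rounding.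
\<close>

lemma bad_pairs_bound:
  fixes d s :: real
  assumes r: "r \<ge> 3" and s: "s > 1" and k: "k \<ge> 1" and n: "n \<ge> r" and d: "d \<ge> 1"
    and M: "real M \<le> 2 * real n * d" "M \<le> n choose r" and m: "real m \<ge> s * real k / real r"
    and y: "2 * exp 1 ^ 2 * real r ^ (r + 1) * d * (real k / real n) ^ (r - 1) \<le> 1"
    and \<beta>: "\<beta> = ((real r - 1) * s - real r) / real r" and \<alpha>: "\<alpha> * \<beta> = s / real r"
  shows "real (n choose k) * (real ((k choose r) choose m) * (real (M choose m) / real ((n choose r) choose m)))
    \<le> (exp 1 * (2 * exp 1 ^ 2 * real r ^ (r + 1)) powr (s / real r)
        * (real k / (real n * d powr (- \<alpha>))) powr \<beta>) ^ k"
proof -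
  \<comment> \<open>The factors of \<open>C1\<close> are collected in the bound below: one
    \<open>e\<close> from each of two binomial estimates, 2 from \<open>M\<close>, \<open>r\<close>
    from \<open>m\<close> being at least \<open>k / r\<close>, and \<open>r ^ r\<close> from the
    lower bound on \<open>n choose r\<close>.\<close>
  define C1 where "C1 = 2 * exp 1 ^ 2 * real r ^ (r + 1)"
  define y where "y = C1 * d * (real k / real n) ^ (r - 1)"
  have C1: "C1 > 0" using r by (simp add: C1_def)
  have n0: "real n > 0" and k0: "real k > 0" and r0: "real r > 0" using n r k by auto
  have y0: "y > 0" using C1 d n0 k0 by (simp add: y_def)
  have y1: "y \<le> 1" using y by (simp add: y_def C1_def)
  have "s * real k / real r > 0" using s k0 r0 by simp
  then have m1: "m \<ge> 1" using m by (cases m) auto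
  define N where "N = real (n choose r)"
  have N: "(real n / real r) ^ r \<le> N"
    unfolding N_def using binomial_ge_n_over_k_pow_k[OF n, where 'a = real] by simp
  have N0: "(real n / real r) ^ r > 0" using n0 r0 by simp
  have mk: "real k / real r \<le> real m"
  proof -
    have "1 * real k / real r \<le> s * real k / real r"
      using s k0 r0 by (intro divide_right_mono mult_right_mono) auto
    with m show ?thesis by simp
  qed
  have "real (k choose r) \<le> real k ^ r"
    by (metis binomial_le_pow binomial_eq_0 not_le of_nat_0_le_iff of_nat_power zero_le_power of_nat_le_iff of_nat_0)
  then have "exp 1 * real (k choose r) / real m \<le> exp 1 * real k ^ r / (real k / real r)"
    using mk k0 r0 by (intro frac_le mult_left_mono) auto
  moreover have "exp 1 * real M / N \<le> exp 1 * (2 * real n * d) / ((real n / real r) ^ r)"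
    using M N N0 d by (intro frac_le mult_left_mono) auto
  ultimately have "(exp 1 * real (k choose r) / real m) * (exp 1 * real M / N) \<le>
      (exp 1 * real k ^ r / (real k / real r)) * (exp 1 * (2 * real n * d) / ((real n / real r) ^ r))"
    using N N0 d by (intro mult_mono) auto
  also have "\<dots> = y"
  proof -
    obtain q where q: "r = Suc q" using r by (cases r) auto
    show ?thesis unfolding y_def C1_def q using k0 n0 r0
      by (simp add: field_simps power2_eq_square del: of_nat_Suc)
  qed
  finally have xy: "(exp 1 * real (k choose r) / real m) * (exp 1 * real M / N) \<le> y" .
  have "real ((k choose r) choose m) * (real (M choose m) / real ((n choose r) choose m)) \<le>
      (exp 1 * real (k choose r) / real m) ^ m * (exp 1 * real M / N) ^ m"
    unfolding N_def
    using choose_le_exp_power[OF m1] choose_ratio_le[OF m1 M(2)] by (intro mult_mono) auto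
  also have "\<dots> \<le> y ^ m"
    unfolding power_mult_distrib[symmetric] using xy by (intro power_mono) (auto simp: N_def)
  also have "\<dots> = y powr real m"
    using y0 by (simp add: powr_realpow)
  also have "\<dots> \<le> y powr (s * real k / real r)"
    using m y0 y1 by (intro powr_mono') auto
  also have "\<dots> = (y powr (s / real r)) ^ k"
    using y0 by (simp add: powr_powr flip: powr_realpow)
  finally have "real (n choose k) * (real ((k choose r) choose m) * (real (M choose m) / real ((n choose r) choose m)))
    \<le> (exp 1 * real n / real k) ^ k * (y powr (s / real r)) ^ k"
    using choose_le_exp_power[OF k] by (intro mult_mono) auto
  also have "\<dots> = (exp 1 * (real n / real k) * y powr (s / real r)) ^ k"
    by (simp add: mult_ac flip: power_mult_distrib)
  \<comment> \<open>With \<open>z = k / n\<close>, the exponent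
    \<open>(r - 1) s / r = \<beta> + 1\<close> of \<open>z\<close> loses 1 to the factor
    \<open>n / k\<close>. Since \<alpha>\<beta> = s/r, the remaining powers of \<open>d\<close> and
    \<open>z\<close> combine into a \<beta>-th power of \<open>z * d powr \<alpha>\<close>, that is,
    of \<open>k / w\<close>.\<close>
  also have "exp 1 * (real n / real k) * y powr (s / real r) =
    exp 1 * C1 powr (s / real r) * (real k / (real n * d powr (- \<alpha>))) powr \<beta>"
  proof -
    define z where "z = real k / real n"
    have z: "z > 0" using k0 n0 by (simp add: z_def)
    have "y = C1 * d * z powr (real r - 1)"
      using z r unfolding y_def z_def[symmetric]
      by (simp add: of_nat_diff flip: powr_realpow)
    then have "y powr (s / real r) = C1 powr (s / real r) * d powr (s / real r) * z powr ((real r - 1) * (s / real r))"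
      using C1 d z by (simp add: powr_mult powr_powr)
    also have "(real r - 1) * (s / real r) = \<beta> + 1"
      unfolding \<beta> using r0 by (simp add: field_simps)
    also have "z powr (\<beta> + 1) = z powr \<beta> * z"
      using z by (simp add: powr_add)
    finally have *: "y powr (s / real r) = C1 powr (s / real r) * d powr (s / real r) * (z powr \<beta> * z)" .
    have "real k / (real n * d powr (- \<alpha>)) = z * d powr \<alpha>"
      using d by (simp add: z_def powr_minus field_simps)
    then have "(real k / (real n * d powr (- \<alpha>))) powr \<beta> = z powr \<beta> * d powr (s / real r)"
      using z d \<alpha> by (simp add: powr_mult powr_powr)
    moreover have "real n / real k = 1 / z" by (simp add: z_def)
    ultimately show ?thesis unfolding * using z by simp
  qed
  finally show ?thesis unfolding C1_def .
qed

section \<open>From sparse hypergraphs to lower bounds for \<open>t_sub\<close>\<close>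

lemma t_sub_greater:
  fixes H :: "nat hypergraph"
  assumes H: "r_graph r H" "card (hverts H) = n" "avg_degree r H \<ge> d"
    and n: "n \<ge> 1" and r: "r \<ge> 1" and "s \<le> d"
    and sparse: "\<And>U. U \<subseteq> hverts H \<Longrightarrow> U \<noteq> {} \<Longrightarrow> card U \<le> t \<Longrightarrow>
      real (card (hedges H \<inter> nsets U r)) < s * real (card U) / real r"
  shows "t_sub r n d s > t"
proof (rule ccontr)
  assume "\<not> ?thesis"
  then have le: "t_sub r n d s \<le> t" by simp
  \<comment> \<open>Some bound must qualify before the \<open>LEAST\<close> in \<open>t_sub\<close>
    is known to qualify itself; \<open>n\<close> does, with the whole hypergraph as witness.\<close>
  have "dense_sub_bound r n d s n"
    unfolding dense_sub_bound_def
  proof (intro allI impI)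
    fix G :: "nat hypergraph"
    assume "r_graph r G \<and> card (hverts G) = n \<and> d \<le> avg_degree r G"
    then show "\<exists>H'. r_graph r H' \<and> subhypergraph H' G \<and> hverts H' \<noteq> {} \<and>
              card (hverts H') \<le> n \<and> avg_degree r H' \<ge> s"
      using n \<open>s \<le> d\<close> by (intro exI[of _ G]) (auto simp: subhypergraph_def)
  qed
  then have "dense_sub_bound r n d s (t_sub r n d s)"
    unfolding t_sub_def by (rule LeastI)
  then have "\<exists>H'. r_graph r H' \<and> subhypergraph H' H \<and> hverts H' \<noteq> {} \<and>
      card (hverts H') \<le> t_sub r n d s \<and> avg_degree r H' \<ge> s"
    using H unfolding dense_sub_bound_def by blast
  then obtain H' where H': "r_graph r H'" "subhypergraph H' H" "hverts H' \<noteq> {}"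
      "card (hverts H') \<le> t" "avg_degree r H' \<ge> s"
    using le order_trans by blast
  let ?U = "hverts H'"
  have fin: "finite ?U" using H'(1) by (simp add: r_graph_def)
  have "hedges H' \<subseteq> hedges H \<inter> nsets ?U r"
    using H'(1,2) by (auto simp: r_graph_def subhypergraph_def)
  then have "card (hedges H') \<le> card (hedges H \<inter> nsets ?U r)"
    using fin by (intro card_mono) (auto intro: finite_imp_finite_nsets)
  moreover have "card ?U > 0" using fin H'(3) by (simp add: card_gt_0_iff)
  then have "s * real (card ?U) / real r \<le> real (card (hedges H'))"
    using H'(5) r by (simp add: avg_degree_def field_simps)
  ultimately show False
    using sparse[of ?U] H'(2-4) by (auto simp: subhypergraph_def)
qed

text \<open>The number \<open>M\<close> is at least twice the \<open>nd/r\<close> edges needed for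
  average degree \<open>d\<close>, so deleting at most \<open>nd/r\<close> edges is
  affordable.\<close>

lemma t_sub_greater_of_sum_le:
  fixes d s :: real and n r M :: nat
  defines "m \<equiv> \<lambda>k. nat \<lceil>s * real k / real r\<rceil>"
  assumes n: "n \<ge> 1" and r: "r \<ge> 1" and s: "s > 0" "s \<le> d"
    and M: "M \<le> n choose r" "real M \<ge> 2 * real n * d / real r"
    and sum: "(\<Sum>k=1..t. real (n choose k) *
        (real ((k choose r) choose m k) * (real (M choose m k) / real ((n choose r) choose m k))))
      \<le> real n * d / real r"
  shows "t_sub r n d s > t"
proof -
  have m: "m k \<ge> 1" if "k \<ge> 1" for k
  proof -
    have "s * real k / real r > 0" using s r that by simp
    then show ?thesis by (simp add: m_def le_nat_iff)
  qed
  obtain A where A: "A \<subseteq> nsets {..<n} r"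
    "\<And>U. U \<subseteq> {..<n} \<Longrightarrow> U \<noteq> {} \<Longrightarrow> card U \<le> t \<Longrightarrow> card (A \<inter> nsets U r) < m (card U)"
    "real (card A) \<ge> real M - (\<Sum>k=1..t. real (n choose k) *
        (real ((k choose r) choose m k) * (real (M choose m k) / real ((n choose r) choose m k))))"
    by (rule exists_locally_sparse[OF M(1), where m = m and t = t]) (use m that in blast)+
  show ?thesis
  proof (rule t_sub_greater[where H = "({..<n}, A)"])
    have "real (card A) \<ge> real n * d / real r"
      using A(3) sum M(2) by (simp add: field_simps)
    then show "avg_degree r ({..<n}, A) \<ge> d"
      using n r by (simp add: avg_degree_def field_simps)
    fix U assume "U \<subseteq> hverts ({..<n}, A)" "U \<noteq> {}" "card U \<le> t"
    then have "card (A \<inter> nsets U r) < m (card U)" using A(2) by simp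
    \<comment> \<open>An integer lies below the ceiling of a real exactly when it lies below the
      real, so rounding up in \<open>m\<close> loses nothing.\<close>
    then have "int (card (A \<inter> nsets U r)) < \<lceil>s * real (card U) / real r\<rceil>"
      unfolding m_def by linarith
    then show "real (card (hedges ({..<n}, A) \<inter> nsets U r)) < s * real (card U) / real r"
      by (simp add: less_ceiling_iff)
  qed (use A n r s in \<open>auto simp: r_graph_def\<close>)
qed

section \<open>Conditions on large \<open>n\<close>\<close>

text \<open>The threshold on \<open>n\<close> must not depend on \<open>d\<close>. Hence the last
  condition ranges over all \<open>x\<close> from \<open>ln n\<close> on: it will be used at
  \<open>x = \<Lambda>\<close>, which varies with \<open>d\<close> but is at least
  \<open>ln n\<close>. The second condition will provide \<open>M\<close> edges, and the third the
  hypothesis \<open>y\<close> of \<open>bad_pairs_bound\<close> for \<open>k\<close> up to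
  \<Lambda>.\<close>

lemma eventually_large_conditions:
  fixes C1 a b R :: real and q :: nat
  assumes "C1 > 0" "a > 0" "b > 0" "R > 0"
  shows "\<forall>\<^sub>F n in sequentially.
    K \<le> n \<and> B \<le> real n powr a \<and> C1 * (b * ln (real n)) ^ q * real n powr (- a) \<le> 1 \<and>
    (\<forall>x\<ge>ln (real n). x * exp (x / 2) \<le> (exp x - 2) / R)"
proof (intro eventually_conj)
  show "\<forall>\<^sub>F n in sequentially. K \<le> n" by (rule eventually_ge_at_top)
  have "filterlim (\<lambda>n. real n powr a) at_top sequentially"
    using assms by real_asymp
  then show "\<forall>\<^sub>F n in sequentially. B \<le> real n powr a"
    by (simp add: filterlim_at_top)
  have "((\<lambda>n. C1 * (b * ln (real n)) ^ q * real n powr (- a)) \<longlongrightarrow> 0) sequentially"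
    using assms by real_asymp
  then have "\<forall>\<^sub>F n in sequentially. C1 * (b * ln (real n)) ^ q * real n powr (- a) < 1"
    by (rule order_tendstoD) simp
  then show "\<forall>\<^sub>F n in sequentially. C1 * (b * ln (real n)) ^ q * real n powr (- a) \<le> 1"
    by eventually_elim simp
  have "\<forall>\<^sub>F x in at_top. x * exp (x / 2) \<le> (exp x - 2) / R"
    using assms by real_asymp
  then obtain x0 where x0: "\<And>x. x \<ge> x0 \<Longrightarrow> x * exp (x / 2) \<le> (exp x - 2) / R"
    by (auto simp: eventually_at_top_linorder)
  have "filterlim (\<lambda>n. ln (real n)) at_top sequentially"
    by real_asymp
  then have "\<forall>\<^sub>F n in sequentially. x0 \<le> ln (real n)"
    by (simp add: filterlim_at_top)
  then show "\<forall>\<^sub>F n in sequentially. \<forall>x\<ge>ln (real n). x * exp (x / 2) \<le> (exp x - 2) / R"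
    by eventually_elim (auto intro: x0)
qed

section \<open>Choice of constants and the two regimes\<close>

theorem theorem3:
  fixes r :: nat and s :: real
  assumes "r \<ge> 3" and "s > real r / (real r - 1)"
  shows "\<exists>c>0. \<forall>\<^sub>F n in sequentially. \<forall>d::real.
           s \<le> d \<and> d \<le> real n powr (1 / alpha r s) \<longrightarrow>
           (let w = real n * d powr (- alpha r s);
                \<Lambda> = ln (2 + real n * d)
            in real (t_sub r n d s) \<ge> c * (w + \<Lambda> / ln (2 + \<Lambda> / w)))"
proof -
  define \<alpha> where "\<alpha> = alpha r s"
  define D where "D = (real r - 1) * s - real r"
  define \<beta> where "\<beta> = D / real r"
  define C1 where "C1 = 2 * exp 1 ^ 2 * real r ^ (r + 1)"
  define C2 where "C2 = exp 1 * C1 powr (s / real r)"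
  define C3 where "C3 = 2 * ln C2 + \<beta>"
  \<comment> \<open>In order, the entries give: base at most 1 in the power with exponent
    \<open>m\<close> when \<Lambda>/l is at most \<open>w\<close>, and also \<open>c\<close> at most
    1/4; at most \<open>nd/r\<close> terms in that case; exponent at most \<Lambda>/2 in the other
    case; and \<open>C2 * (2 * c) powr \<beta>\<close> at most 1.\<close>
  define c where "c = Min {1 / (4 * C1), 1 / (4 * real r), 1 / (4 * C3), C2 powr (- 1 / \<beta>) / 2}"
  have r0: "real r > 0" "real r \<ge> 3" using assms(1) by auto
  have D0: "D > 0"
    using assms r0 by (simp add: D_def field_simps)
  have s1: "s > 1"
  proof -
    have "real r / (real r - 1) > 1" using r0 by (simp add: field_simps)
    with assms(2) show ?thesis by linarith
  qed
  have \<alpha>: "\<alpha> = s / D" by (simp add: \<alpha>_def alpha_def D_def)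
  have \<alpha>0: "\<alpha> > 0" using \<alpha> D0 s1 by simp
  have \<beta>0: "\<beta> > 0" using D0 r0 by (simp add: \<beta>_def)
  have \<alpha>\<beta>: "\<alpha> * \<beta> = s / real r" using D0 by (simp add: \<alpha> \<beta>_def)
  have \<alpha>r: "\<alpha> * (real r - 1) \<ge> 1"
    using D0 r0 by (simp add: \<alpha> D_def field_simps)
  \<comment> \<open>In this form the upper limit on \<open>d\<close> says that \<open>nd\<close> is
    at most \<open>n powr (r - r/s)\<close>. The gap of \<open>n powr (r/s)\<close> below
    \<open>n ^ r\<close> absorbs constants and logarithms later.\<close>
  have inv\<alpha>: "1 / \<alpha> = real r - 1 - real r / s"
    using D0 s1 by (simp add: \<alpha> D_def field_simps)
  have C1: "C1 \<ge> 1"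
  proof -
    have "1 * 1 * 1 \<le> C1" unfolding C1_def
      using r0 by (intro mult_mono one_le_power) auto
    then show ?thesis by simp
  qed
  have C2: "C2 \<ge> 1"
  proof -
    have "1 * 1 \<le> C2" unfolding C2_def
      using r0 C1 s1 by (intro mult_mono ge_one_powr_ge_zero) auto
    then show ?thesis by simp
  qed
  have C3: "C3 > 0" using C2 \<beta>0 by (simp add: C3_def add_nonneg_pos)
  have c0: "c > 0" unfolding c_def using C1 C2 C3 r0 by simp
  have c1: "c \<le> 1 / (4 * C1)" and c2: "c \<le> 1 / (4 * real r)"
    and c3: "c \<le> 1 / (4 * C3)" and c4: "c \<le> C2 powr (- 1 / \<beta>) / 2"
    unfolding c_def by (rule Min_le; simp)+
  have cq: "c \<le> 1 / 4"
  proof -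
    have "1 / (4 * C1) \<le> 1 / 4" using C1 by (simp add: field_simps)
    with c1 show ?thesis by linarith
  qed
  have C1c: "C1 * (2 * c) ^ (r - 1) \<le> 1"
  proof -
    have "(2 * c) ^ (r - 1) \<le> (2 * c) ^ 1"
      using cq c0 assms(1) by (intro power_decreasing) auto
    then have "C1 * (2 * c) ^ (r - 1) \<le> C1 * (2 * c)"
      using C1 by simp
    also have "\<dots> \<le> 1" using c1 C1 c0 by (simp add: field_simps)
    finally show ?thesis .
  qed
  have C2c: "C2 * (2 * c) powr \<beta> \<le> 1"
  proof -
    have "(2 * c) powr \<beta> \<le> (C2 powr (- 1 / \<beta>)) powr \<beta>"
      using c4 c0 \<beta>0 by (intro powr_mono2) auto
    also have "\<dots> = C2 powr (- 1)"
      using \<beta>0 by (simp only: powr_powr) simp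
    also have "\<dots> = 1 / C2"
      using C2 by (simp add: powr_minus_divide)
    finally show ?thesis using C2 by (simp add: field_simps)
  qed
  have "\<forall>\<^sub>F n in sequentially. r \<le> n \<and> 2 * real r ^ r \<le> real n powr (real r / s) \<and>
    C1 * ((real r + 1) * ln (real n)) ^ (r - 1) * real n powr (- (real r / s)) \<le> 1 \<and>
    (\<forall>x\<ge>ln (real n). x * exp (x / 2) \<le> (exp x - 2) / real r)"
    using C1 s1 r0 by (intro eventually_large_conditions) auto
  then have "\<forall>\<^sub>F n in sequentially. \<forall>d::real.
           s \<le> d \<and> d \<le> real n powr (1 / alpha r s) \<longrightarrow>
           (let w = real n * d powr (- alpha r s);
                \<Lambda> = ln (2 + real n * d)
            in real (t_sub r n d s) \<ge> c * (w + \<Lambda> / ln (2 + \<Lambda> / w)))"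
  proof eventually_elim
    case (elim n)
    then have nr: "n \<ge> r" and big1: "2 * real r ^ r \<le> real n powr (real r / s)"
      and big2: "C1 * ((real r + 1) * ln (real n)) ^ (r - 1) * real n powr (- (real r / s)) \<le> 1"
      and big3: "\<And>x. x \<ge> ln (real n) \<Longrightarrow> x * exp (x / 2) \<le> (exp x - 2) / real r"
      by auto
    have n3: "real n \<ge> 3" using nr assms(1) by linarith
    show ?case
    proof (intro allI impI)
      fix d :: real
      assume "s \<le> d \<and> d \<le> real n powr (1 / alpha r s)"
      then have sd: "s \<le> d" and dn: "d \<le> real n powr (real r - 1 - real r / s)"
        by (auto simp: inv\<alpha>[symmetric] \<alpha>_def)
      have d1: "d \<ge> 1" using sd s1 by simp
      define w where "w = real n * d powr (- \<alpha>)"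
      define \<Lambda> where "\<Lambda> = ln (2 + real n * d)"
      define l where "l = ln (2 + \<Lambda> / w)"
      define t where "t = t_sub r n d s"
      define M where "M = nat \<lceil>2 * real n * d / real r\<rceil>"
      define m where "m = (\<lambda>k. nat \<lceil>s * real k / real r\<rceil>)"
      define h where "h = (\<lambda>k. real (n choose k) * (real ((k choose r) choose m k) *
        (real (M choose m k) / real ((n choose r) choose m k))))"
      have nd: "real n * d \<ge> 3"
        using mult_mono[OF n3 d1] n3 by simp
      have w0: "w > 0" using n3 d1 by (simp add: w_def)
      have wn: "w \<le> real n"
      proof -
        have "d powr (- \<alpha>) \<le> d powr 0" using d1 \<alpha>0 by (intro powr_mono) auto
        then show ?thesis using d1 n3 by (simp add: w_def mult_left_le)
      qed
      have n_le_nd: "real n \<le> real n * d"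
        using d1 n3 by (simp add: mult_le_cancel_left1)
      have \<Lambda>n: "ln (real n) \<le> \<Lambda>"
        using n3 n_le_nd unfolding \<Lambda>_def by (intro ln_mono) linarith+
      have \<Lambda>0: "\<Lambda> > 0" unfolding \<Lambda>_def using nd by (intro ln_gt_zero) linarith
      have exp\<Lambda>: "exp \<Lambda> = 2 + real n * d" unfolding \<Lambda>_def using nd by simp
      \<comment> \<open>This allows additive constants to be absorbed into multiples of
        \<open>l\<close>.\<close>
      have l: "l \<ge> 1 / 2"
      proof -
        have "ln 2 \<le> l" unfolding l_def using \<Lambda>0 w0 by (intro ln_mono) auto
        moreover have "ln 2 \<ge> (1 / 2 :: real)"
          using ln_le_minus_one[of "1 / 2 :: real"] by (simp add: ln_div)
        ultimately show ?thesis by linarith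
      qed
      have expl: "exp l = 2 + \<Lambda> / w" unfolding l_def using \<Lambda>0 w0 by (simp add: add_pos_pos)
      have nd_le: "real n * d \<le> real n powr (real r - real r / s)"
      proof -
        have "real n * d \<le> real n powr 1 * real n powr (real r - 1 - real r / s)"
          using dn n3 by simp
        also have "\<dots> = real n powr (real r - real r / s)"
          by (subst powr_add[symmetric]) simp
        finally show ?thesis .
      qed
      have \<Lambda>_le: "\<Lambda> \<le> (real r + 1) * ln (real n)"
      proof -
        have "real n powr (real r - real r / s) \<le> real n powr real r"
          using n3 r0 s1 by (intro powr_mono) auto
        then have "real n * d \<le> real n powr real r" using nd_le by linarith
        then have "2 + real n * d \<le> 3 * real n powr real r" using nd by linarith
        also have "\<dots> \<le> real n * real n powr real r" using n3 by simp
        also have "\<dots> = real n powr (real r + 1)" using n3 by (simp add: powr_add)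
        finally have "\<Lambda> \<le> ln (real n powr (real r + 1))"
          unfolding \<Lambda>_def using nd by (intro ln_mono) linarith+
        then show ?thesis using n3 by (simp add: ln_powr)
      qed
      have M_ge: "real M \<ge> 2 * real n * d / real r" unfolding M_def by linarith
      have M_le: "real M \<le> 2 * real n * d"
      proof -
        have "2 * real n * d / real r \<ge> 0" using d1 by simp
        then have "real M \<le> 2 * real n * d / real r + 1" unfolding M_def by linarith
        \<comment> \<open>Since \<open>r\<close> and \<open>nd\<close> are both at least 3, the 1
          lost by rounding up fits into the larger bound \<open>2nd\<close>.\<close>
        also have "2 * real n * d / real r \<le> 2 * real n * d / 3"
          using r0 d1 by (intro divide_left_mono) auto
        finally show ?thesis using nd by linarith
      qed
      have M_le_choose: "M \<le> n choose r"
      proof -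
        have "2 * real r ^ r * (real n * d) \<le> real n powr (real r / s) * real n powr (real r - real r / s)"
          using big1 nd_le d1 by (intro mult_mono) auto
        also have "\<dots> = real n ^ r" using n3 by (simp flip: powr_add powr_realpow)
        finally have "2 * real n * d \<le> (real n / real r) ^ r"
          using r0 by (simp add: field_simps)
        also have "\<dots> \<le> real (n choose r)"
          using binomial_ge_n_over_k_pow_k[OF nr, where 'a = real] by simp
        finally show ?thesis using M_le by linarith
      qed
      have term_le: "h k \<le> (C2 * (real k / w) powr \<beta>) ^ k"
        if "k \<ge> 1" "C1 * d * (real k / real n) ^ (r - 1) \<le> 1" for k
      proof -
        have "real (m k) \<ge> s * real k / real r" unfolding m_def by linarith
        then show ?thesis
          using bad_pairs_bound[OF assms(1) s1 that(1) nr d1 M_le M_le_choose _ _ \<beta>_def[unfolded D_def] \<alpha>\<beta>]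
            that(2) unfolding h_def C1_def C2_def w_def by simp
      qed
      \<comment> \<open>If this failed for \<open>t\<close>, which is \<open>t_sub\<close> itself,
        the sparse construction would make \<open>t_sub\<close> larger than itself.\<close>
      have "c * (w + \<Lambda> / l) \<le> real t"
      proof (rule ccontr)
        assume "\<not> ?thesis"
        then have tlt: "real t < c * (w + \<Lambda> / l)" by simp
        have "sum h {1..t} \<le> real n * d / real r"
        proof (cases "\<Lambda> / l \<le> w")
          case True
          have tw: "real t \<le> 2 * c * w"
          proof -
            have "c * (w + \<Lambda> / l) \<le> c * (w + w)" using True c0 by simp
            with tlt show ?thesis by (simp add: algebra_simps)
          qed
          have "h k \<le> 1" if k: "k \<in> {1..t}" for k
          proof -
            have kw: "real k / w \<le> 2 * c" using tw k w0 by (simp add: field_simps)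
            \<comment> \<open>This is \<open>k / w\<close> at most \<open>2c\<close> rewritten in
              terms of \<open>n\<close>. Multiplying the \<open>(r - 1)\<close>-st power by
              \<open>d\<close> leaves the exponent \<open>1 - \<alpha> * (r - 1)\<close> on
              \<open>d\<close>, which is at most 0 by \<open>\<alpha>r\<close>.\<close>
            have "real k / real n \<le> 2 * c * d powr (- \<alpha>)"
              using tw k n3 by (simp add: field_simps w_def)
            then have "(real k / real n) ^ (r - 1) \<le> (2 * c * d powr (- \<alpha>)) ^ (r - 1)"
              by (intro power_mono) auto
            also have "\<dots> = (2 * c) ^ (r - 1) * d powr (- \<alpha> * (real r - 1))"
              using d1 assms(1) by (simp add: power_mult_distrib powr_powr of_nat_diff flip: powr_realpow)
            finally have "C1 * d * (real k / real n) ^ (r - 1) \<le>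
                C1 * d * ((2 * c) ^ (r - 1) * d powr (- \<alpha> * (real r - 1)))"
              using C1 d1 by (intro mult_left_mono) auto
            also have "\<dots> = C1 * (2 * c) ^ (r - 1) * d powr (1 - \<alpha> * (real r - 1))"
              using d1 by (simp add: diff_conv_add_uminus powr_add del: add_uminus_conv_diff)
            also have "\<dots> \<le> 1 * d powr 0"
              using C1c \<alpha>r d1 by (intro mult_mono powr_mono) auto
            finally have "C1 * d * (real k / real n) ^ (r - 1) \<le> 1" using d1 by simp
            then have "h k \<le> (C2 * (real k / w) powr \<beta>) ^ k" using term_le k by simp
            also have "\<dots> \<le> (C2 * (2 * c) powr \<beta>) ^ k"
              using kw w0 C2 \<beta>0 by (intro power_mono mult_left_mono powr_mono2) auto
            also have "\<dots> \<le> 1" using C2c C2 by (intro power_le_one) auto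
            finally show ?thesis .
          qed
          then have "sum h {1..t} \<le> real (card {1..t}) * 1" by (rule sum_bounded_above)
          also have "\<dots> \<le> 2 * c * w" using tw by simp
          also have "\<dots> \<le> 2 * (1 / (4 * real r)) * (real n * d)"
            using c2 c0 order_trans[OF wn n_le_nd] w0 by (intro mult_mono) auto
          also have "\<dots> \<le> real n * d / real r" using nd r0 by (simp add: field_simps)
          finally show ?thesis .
        next
          case False
          have tL: "real t \<le> 2 * c * (\<Lambda> / l)"
          proof -
            have "c * (w + \<Lambda> / l) \<le> c * (\<Lambda> / l + \<Lambda> / l)"
              using False c0 by (intro mult_left_mono add_right_mono) auto
            with tlt show ?thesis by (simp add: algebra_simps)
          qed
          have tl: "real t * l \<le> 2 * c * \<Lambda>" using tL l by (simp add: field_simps)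
          \<comment> \<open>This bounds both the number of terms and, through \<open>k\<close> at
            most \<Lambda>, the base of each term.\<close>
          have t\<Lambda>: "real t \<le> \<Lambda>"
          proof -
            have "real t * (1 / 2) \<le> real t * l" using l by (intro mult_left_mono) auto
            moreover have "2 * c * \<Lambda> \<le> 2 * (1 / 4) * \<Lambda>" using cq c0 \<Lambda>0 by (intro mult_mono) auto
            ultimately show ?thesis using tl by linarith
          qed
          have "h k \<le> exp (\<Lambda> / 2)" if k: "k \<in> {1..t}" for k
          proof -
            have k\<Lambda>: "real k \<le> \<Lambda>" using k t\<Lambda> by simp
            have kl: "real k * l \<le> 2 * c * \<Lambda>"
            proof -
              have "real k * l \<le> real t * l" using k l by (intro mult_right_mono) auto
              with tl show ?thesis by linarith
            qed
            \<comment> \<open>Here \<open>k\<close> is at most logarithmic in \<open>n\<close>, so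
              the limit on \<open>d\<close> leaves a power of a logarithm times
              \<open>n powr (- (r/s))\<close>, which is small for large \<open>n\<close>.\<close>
            have "d * (real k / real n) ^ (r - 1) \<le>
                real n powr (real r - 1 - real r / s) * (((real r + 1) * ln (real n)) / real n) ^ (r - 1)"
              using dn k\<Lambda> \<Lambda>_le n3 d1 by (intro mult_mono power_mono divide_right_mono) auto
            also have "\<dots> = ((real r + 1) * ln (real n)) ^ (r - 1) * real n powr (- (real r / s))"
            proof -
              have "real n powr (real r - 1 - real r / s) =
                  real n powr (real r - 1) * real n powr (- (real r / s))"
                by (subst powr_add[symmetric]) simp
              also have "real n powr (real r - 1) = real n ^ (r - 1)"
                using n3 assms(1) by (simp add: of_nat_diff flip: powr_realpow)
              finally show ?thesis using n3 by (simp add: power_divide)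
            qed
            finally have "C1 * (d * (real k / real n) ^ (r - 1)) \<le>
                C1 * (((real r + 1) * ln (real n)) ^ (r - 1) * real n powr (- (real r / s)))"
              using C1 by (intro mult_left_mono) auto
            then have "C1 * d * (real k / real n) ^ (r - 1) \<le> 1" using big2 by (simp add: mult_ac)
            then have "h k \<le> (C2 * (real k / w) powr \<beta>) ^ k" using term_le k by simp
            \<comment> \<open>The logarithm in the denominator of the theorem originates here:
              \<open>k / w\<close> is at most \<open>exp l\<close>, so the term is at most an
              exponential of a constant times \<open>k * l\<close>, and \<open>k * l\<close> is at
              most \<open>2 * c * \<Lambda>\<close>.\<close>
            also have "\<dots> \<le> (C2 * (exp l) powr \<beta>) ^ k"
            proof -
              have "real k / w \<le> \<Lambda> / w" using k\<Lambda> w0 by (simp add: divide_right_mono)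
              also have "\<dots> \<le> exp l" by (simp add: expl)
              finally show ?thesis
                using w0 C2 \<beta>0 by (intro power_mono mult_left_mono powr_mono2) auto
            qed
            also have "\<dots> = exp (real k * (ln C2 + \<beta> * l))"
              using C2 by (simp add: powr_def exp_add exp_of_nat_mult)
            also have "\<dots> \<le> exp (\<Lambda> / 2)"
            proof -
              have "ln C2 * 1 \<le> ln C2 * (2 * l)" using C2 l by (intro mult_left_mono) auto
              then have "ln C2 + \<beta> * l \<le> C3 * l" by (simp add: C3_def algebra_simps)
              then have "real k * (ln C2 + \<beta> * l) \<le> real k * (C3 * l)" by (intro mult_left_mono) auto
              also have "\<dots> = C3 * (real k * l)" by simp
              also have "\<dots> \<le> C3 * (2 * c * \<Lambda>)" using kl C3 by (intro mult_left_mono) auto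
              also have "\<dots> = (C3 * c) * (2 * \<Lambda>)" by simp
              also have "\<dots> \<le> (1 / 4) * (2 * \<Lambda>)"
                using c3 C3 \<Lambda>0 by (intro mult_right_mono) (auto simp: field_simps)
              finally show ?thesis by simp
            qed
            finally show ?thesis .
          qed
          then have "sum h {1..t} \<le> real (card {1..t}) * exp (\<Lambda> / 2)" by (rule sum_bounded_above)
          also have "\<dots> \<le> \<Lambda> * exp (\<Lambda> / 2)" using t\<Lambda> by simp
          \<comment> \<open>The right side is exactly \<open>nd/r\<close>, because
            \<open>exp \<Lambda>\<close> is \<open>2 + nd\<close>.\<close>
          also have "\<dots> \<le> (exp \<Lambda> - 2) / real r" using big3 \<Lambda>n by simp
          finally show ?thesis by (simp add: exp\<Lambda>)
        qed
        then have "t_sub r n d s > t"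
          using t_sub_greater_of_sum_le[of n r s d M t] n3 r0 s1 sd M_le_choose M_ge nr assms(1)
          unfolding h_def m_def by simp
        then show False by (simp add: t_def)
      qed
      then show "let w = real n * d powr (- alpha r s); \<Lambda> = ln (2 + real n * d)
            in real (t_sub r n d s) \<ge> c * (w + \<Lambda> / ln (2 + \<Lambda> / w))"
        by (simp add: Let_def w_def \<Lambda>_def l_def t_def \<alpha>_def)
    qed
  qed
  with c0 show ?thesis by blast
qed

end
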